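(* Let $S$ be a pseudocompact Tychonoff right topological monoid, let $X$ be a pseudocompact Tychonoff space, and let $\pi : S\times X\to X$ be a separately continuous and quasicontinuous action of $S$ on $X$. Then for every unit (invertible element) $u$ of $S$, $\pi$ is jointly continuous at each point of $\{u\}\times X$.
   Context: A space is pseudocompact if every real-valued continuous function on it is bounded. A right topological monoid is a semigroup $S$ with an identity, endowed with a topology, such that for each $x\in S$ the map $S \to S$, $y\mapsto xy$, is continuous. An action of a semigroup $S$ on a set $X$ is a map $\pi : S\times X\to X$ with $\pi(s_1s_2,x)=\pi(s_1,\pi(s_2,x))$ for all $s_1,s_2\in S$, $x\in X$ (it is not assumed that the identity of $S$ acts as the identity map). A map $f : X\times Y\to Z$ is separately continuous if $y\mapsto f(x,y)$ is continuous for each fixed $x$ and $x\mapsto f(x,y)$ is continuous for each fixed $y$. A function $f : A\to B$ between topological spaces is quasicontinuous if for every $a\in A$, every open $V\subset B$ with $f(a)\in V$ and every open $U\subset A$ with $a\in U$ there is a nonempty open $W\subset U$ with $f(W)\subset V$; for $\pi$ this refers to the product topology on $S\times X$. *)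

theory Defs
  imports "HOL-Analysis.Analysis" "HOL-Algebra.Group"
begin

definition pseudocompact_space :: "'a topology \<Rightarrow> bool" where
  "pseudocompact_space X \<longleftrightarrow>
     (\<forall>f. continuous_map X euclideanreal f \<longrightarrow> bounded (f ` topspace X))"

text \<open>The library's \<^const>\<open>completely_regular_space\<close> carries no separation axiom.\<close>

definition Tychonoff_space :: "'a topology \<Rightarrow> bool" where
  "Tychonoff_space X \<longleftrightarrow> completely_regular_space X \<and> Hausdorff_space X"

text \<open>Authors differ on which translations a ``right topological'' monoid requires to be
  continuous; here it is \<open>y \<mapsto> x y\<close> for every fixed \<open>x\<close>.\<close>

definition right_topological_monoid :: "('s, 'm) monoid_scheme \<Rightarrow> 's topology \<Rightarrow> bool" where
  "right_topological_monoid S T \<longleftrightarrow>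
     Group.monoid S \<and> topspace T = carrier S \<and>
     (\<forall>x \<in> carrier S. continuous_map T T (\<lambda>y. x \<otimes>\<^bsub>S\<^esub> y))"

text \<open>The identity of \<open>S\<close> is not required to act as the identity map.\<close>

definition semigroup_action :: "('s, 'm) monoid_scheme \<Rightarrow> 'x set \<Rightarrow> ('s \<times> 'x \<Rightarrow> 'x) \<Rightarrow> bool" where
  "semigroup_action S A \<pi> \<longleftrightarrow>
     \<pi> \<in> carrier S \<times> A \<rightarrow> A \<and>
     (\<forall>s \<in> carrier S. \<forall>t \<in> carrier S. \<forall>x \<in> A. \<pi> (s \<otimes>\<^bsub>S\<^esub> t, x) = \<pi> (s, \<pi> (t, x)))"

definition separately_continuous_map ::
    "'a topology \<Rightarrow> 'b topology \<Rightarrow> 'c topology \<Rightarrow> ('a \<times> 'b \<Rightarrow> 'c) \<Rightarrow> bool" where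
  "separately_continuous_map X Y Z f \<longleftrightarrow>
     (\<forall>x \<in> topspace X. continuous_map Y Z (\<lambda>y. f (x, y))) \<and>
     (\<forall>y \<in> topspace Y. continuous_map X Z (\<lambda>x. f (x, y)))"

definition quasicontinuous_map :: "'a topology \<Rightarrow> 'b topology \<Rightarrow> ('a \<Rightarrow> 'b) \<Rightarrow> bool" where
  "quasicontinuous_map A B f \<longleftrightarrow>
     f \<in> topspace A \<rightarrow> topspace B \<and>
     (\<forall>a \<in> topspace A. \<forall>V U. openin B V \<and> f a \<in> V \<and> openin A U \<and> a \<in> U \<longrightarrow>
        (\<exists>W. openin A W \<and> W \<noteq> {} \<and> W \<subseteq> U \<and> f ` W \<subseteq> V))"

end

(* Let F (s, y) = g (s y) for a continuous g : X -> [0, 1].  In a pseudocompact completely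
   regular space every sequence of nonempty open sets accumulates at a point; a double-limit
   argument, in which quasicontinuity replaces points by open sets, then shows that every
   nonempty open subset of S contains a nonempty open set on which all F (., y) oscillate little,
   uniformly in y.  If the action is not continuous at (1, x), choose g with g (1 x) = 0 and
   alternately small-oscillation sets U_n close to 1 with points s_n, and y_n = t_n v_n with
   (t_n, v_n) close to (1, x) and g (y_n) = 1.  Since F (s, t v) = F (s t, v) and s_i t_n lies in
   U_i, F is small at (s_i, y_n) for i <= n and near 1 for i > n, and accumulation points of the
   U_n and of neighbourhoods of the y_n give a contradiction.  A unit u reduces to 1 by
   s y = u ((u^-1 s) y). *)

theory Submission
  imports Defs
begin

section \<open>Accumulation points of sequences of sets in pseudocompact spaces\<close>

definition cluster_point_of_sets :: "'a topology \<Rightarrow> (nat \<Rightarrow> 'a set) \<Rightarrow> 'a \<Rightarrow> bool" where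
  "cluster_point_of_sets X V y \<longleftrightarrow>
     y \<in> topspace X \<and> (\<forall>N m. openin X N \<and> y \<in> N \<longrightarrow> (\<exists>n\<ge>m. N \<inter> V n \<noteq> {}))"

lemma cluster_point_of_sets_in_topspace:
  "cluster_point_of_sets X V y \<Longrightarrow> y \<in> topspace X"
  by (simp add: cluster_point_of_sets_def)

lemma cluster_point_of_setsE:
  assumes "cluster_point_of_sets X V y" "openin X N" "y \<in> N"
  obtains n z where "n \<ge> m" "z \<in> N" "z \<in> V n"
  using assms unfolding cluster_point_of_sets_def by blast

text \<open>The set where \<open>f\<close> exceeds \<open>c\<close> is open, so if it contained
  \<open>y\<close> it would meet some late \<open>V n\<close>. Together with its mirror image this
  replaces limits along subsequences, which need not exist here.\<close>

lemma cluster_point_of_sets_le: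
  fixes f :: "'a \<Rightarrow> real"
  assumes y: "cluster_point_of_sets X V y" and f: "continuous_map X euclideanreal f"
    and le: "\<And>n z. n \<ge> m \<Longrightarrow> z \<in> V n \<Longrightarrow> f z \<le> c"
  shows "f y \<le> c"
proof (rule ccontr)
  assume "\<not> f y \<le> c"
  let ?N = "{z \<in> topspace X. f z \<in> {c<..}}"
  have "openin X ?N"
    using f by (rule openin_continuous_map_preimage) simp
  moreover have "y \<in> ?N"
    using \<open>\<not> f y \<le> c\<close> cluster_point_of_sets_in_topspace[OF y] by simp
  ultimately obtain n z where "n \<ge> m" "z \<in> ?N" "z \<in> V n"
    by (rule cluster_point_of_setsE[OF y])
  then show False using le by force
qed

lemma cluster_point_of_sets_ge:
  fixes f :: "'a \<Rightarrow> real"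
  assumes y: "cluster_point_of_sets X V y" and f: "continuous_map X euclideanreal f"
    and ge: "\<And>n z. n \<ge> m \<Longrightarrow> z \<in> V n \<Longrightarrow> c \<le> f z"
  shows "c \<le> f y"
  using cluster_point_of_sets_le[OF y continuous_map_minus[OF f], of m "- c"] ge by force

text \<open>The index set varies with the point, but on each neighbourhood given by local finiteness
  the sum equals one fixed finite sum, and continuity is a local matter.\<close>

lemma continuous_map_locally_finite_sum:
  fixes f :: "nat \<Rightarrow> 'a \<Rightarrow> real"
  assumes f: "\<And>n. continuous_map X euclideanreal (f n)"
    and lf: "\<And>x. x \<in> topspace X \<Longrightarrow>
      \<exists>N m. openin X N \<and> x \<in> N \<and> (\<forall>n\<ge>m. \<forall>z\<in>N. f n z = 0)"
  shows "continuous_map X euclideanreal (\<lambda>x. \<Sum>n | f n x \<noteq> 0. f n x)"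
  unfolding continuous_map_eq_topcontinuous_at
proof
  fix x assume x: "x \<in> topspace X"
  then obtain N m where N: "openin X N" "x \<in> N" and 0: "\<And>n z. n \<ge> m \<Longrightarrow> z \<in> N \<Longrightarrow> f n z = 0"
    using lf by metis
  have eq: "(\<Sum>n | f n z \<noteq> 0. f n z) = (\<Sum>n<m. f n z)" if "z \<in> N" for z
    using 0[OF _ that] by (intro sum.mono_neutral_left) (auto simp: not_le[symmetric])
  have "continuous_map X euclideanreal (\<lambda>z. \<Sum>n<m. f n z)"
    using f by (intro continuous_map_sum) auto
  then have at: "topcontinuous_at X euclideanreal (\<lambda>z. \<Sum>n<m. f n z) x"
    using x by (simp add: continuous_map_eq_topcontinuous_at)
  show "topcontinuous_at X euclideanreal (\<lambda>x. \<Sum>n | f n x \<noteq> 0. f n x) x"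
    unfolding topcontinuous_at_def
  proof (intro conjI allI impI)
    fix V assume V: "openin euclideanreal V \<and> (\<Sum>n | f n x \<noteq> 0. f n x) \<in> V"
    then obtain U where U: "openin X U" "x \<in> U" "\<And>y. y \<in> U \<Longrightarrow> (\<Sum>n<m. f n y) \<in> V"
      using at eq[OF \<open>x \<in> N\<close>] unfolding topcontinuous_at_def by metis
    show "\<exists>U. openin X U \<and> x \<in> U \<and> (\<forall>y\<in>U. (\<Sum>n | f n y \<noteq> 0. f n y) \<in> V)"
      using U N eq by (intro exI[of _ "U \<inter> N"]) auto
  qed (use x in auto)
qed

text \<open>Without an accumulation point the family \<open>V\<close> is locally finite. Bumps of
  height \<open>n\<close> supported in \<open>V n\<close> then add up to a continuous unbounded
  function.\<close>

lemma pseudocompact_cluster_point_of_sets: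
  assumes pc: "pseudocompact_space X" and cr: "completely_regular_space X"
    and V: "\<And>n. openin X (V n)" "\<And>n. V n \<noteq> {}"
  obtains y where "cluster_point_of_sets X V y"
proof (rule ccontr)
  assume "\<not> thesis"
  then have none: "\<not> cluster_point_of_sets X V y" for y using that by blast
  obtain y where y: "\<And>n. y n \<in> V n" using V(2) by (meson ex_in_conv)
  \<comment> \<open>Complete regularity gives \<open>h\<close> with value 0 at \<open>y n\<close>
    and 1 off \<open>V n\<close>; the bump is \<open>n * (1 - h)\<close>.\<close>
  have "\<exists>f. continuous_map X euclideanreal f \<and> f (y n) = real n \<and>
          (\<forall>z \<in> topspace X. f z \<ge> 0) \<and> (\<forall>z \<in> topspace X - V n. f z = 0)" for n
  proof -
    have "closedin X (topspace X - V n)" "y n \<in> topspace X - (topspace X - V n)"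
      using V(1) y openin_subset by fastforce+
    then obtain h where h: "continuous_map X (top_of_set {0..1::real}) h" "h (y n) = 0"
        "h ` (topspace X - V n) \<subseteq> {1}"
      using cr unfolding completely_regular_space_def by metis
    have h': "continuous_map X euclideanreal h" "h \<in> topspace X \<rightarrow> {0..1}"
      using h(1) by (auto simp: continuous_map_in_subtopology)
    have "continuous_map X euclideanreal (\<lambda>z. real n * (1 - h z))"
      using h'(1) by (intro continuous_intros) auto
    moreover have "0 \<le> real n * (1 - h z)" if "z \<in> topspace X" for z
      using h'(2) that by (auto intro!: mult_nonneg_nonneg)
    moreover have "real n * (1 - h z) = 0" if "z \<in> topspace X - V n" for z
      using h(3) that by force
    ultimately show ?thesis
      using h(2) by (intro exI[of _ "\<lambda>z. real n * (1 - h z)"]) simp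
  qed
  then obtain f where f: "\<And>n. continuous_map X euclideanreal (f n)" "\<And>n. f n (y n) = real n"
      "\<And>n z. z \<in> topspace X \<Longrightarrow> f n z \<ge> 0" "\<And>n z. z \<in> topspace X - V n \<Longrightarrow> f n z = 0"
    by metis
  have lf: "\<exists>N m. openin X N \<and> x \<in> N \<and> (\<forall>n\<ge>m. \<forall>z\<in>N. f n z = 0)" if x: "x \<in> topspace X" for x
  proof -
    obtain N m where "openin X N" "x \<in> N" "\<forall>n\<ge>m. N \<inter> V n = {}"
      using none[of x] x unfolding cluster_point_of_sets_def by metis
    moreover have "f n z = 0" if "n \<ge> m" "z \<in> N" for n z
      using calculation that f(4)[of z n] openin_subset by blast
    ultimately show ?thesis by blast
  qed
  let ?g = "\<lambda>x. \<Sum>n | f n x \<noteq> 0. f n x"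
  have "bounded (?g ` topspace X)"
    using pc continuous_map_locally_finite_sum[OF f(1) lf] unfolding pseudocompact_space_def by blast
  then obtain B where "\<forall>x\<in>topspace X. \<bar>?g x\<bar> \<le> B"
    unfolding bounded_real by blast
  then have B: "\<And>x. x \<in> topspace X \<Longrightarrow> ?g x \<le> B" by (meson abs_le_D1)
  \<comment> \<open>Positivity of \<open>n\<close> makes \<open>f n (y n)\<close> a nonzero term,
    hence one of the summands of \<open>?g (y n)\<close>.\<close>
  obtain n :: nat where n: "B < real n" "n > 0"
    using reals_Archimedean2[of "max B 0"] by (auto simp: max_def split: if_splits)
  have yn: "y n \<in> topspace X" using V(1) y openin_subset by blast
  \<comment> \<open>A sum over an infinite index set would be 0 by default, so finiteness has to be
    established before comparing the sum with one term.\<close>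
  obtain N m where "y n \<in> N" "\<forall>k\<ge>m. \<forall>z\<in>N. f k z = 0"
    using lf[OF yn] by blast
  then have "{k. f k (y n) \<noteq> 0} \<subseteq> {..<m}" by (auto simp: not_le[symmetric])
  then have "finite {k. f k (y n) \<noteq> 0}" by (rule finite_subset) simp
  then have "f n (y n) \<le> ?g (y n)"
    using f(2)[of n] f(3)[OF yn] n by (intro member_le_sum) auto
  then show False using B[OF yn] n f(2)[of n] by simp
qed

section \<open>Open sets of uniformly small oscillation for separately continuous, quasicontinuous
  functions\<close>

lemma quasicontinuous_map_prod_box:
  assumes q: "quasicontinuous_map (prod_topology T X) Z f"
    and A: "openin T A" "s \<in> A" and B: "openin X B" "y \<in> B" and G: "openin Z G" "f (s, y) \<in> G"
  obtains A' B' where "openin T A'" "A' \<noteq> {}" "A' \<subseteq> A" "openin X B'" "B' \<noteq> {}" "B' \<subseteq> B"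
    "\<And>a b. a \<in> A' \<Longrightarrow> b \<in> B' \<Longrightarrow> f (a, b) \<in> G"
proof -
  have "openin (prod_topology T X) (A \<times> B)" "(s, y) \<in> A \<times> B"
    using A B by (auto simp: openin_prod_Times_iff)
  moreover then have "(s, y) \<in> topspace (prod_topology T X)"
    using openin_subset by blast
  ultimately obtain W where W: "openin (prod_topology T X) W" "W \<noteq> {}" "W \<subseteq> A \<times> B" "f ` W \<subseteq> G"
    using q G unfolding quasicontinuous_map_def by meson
  \<comment> \<open>Quasicontinuity gives only some nonempty open \<open>W\<close> inside the
    rectangle, so the box surrounds an arbitrary point of \<open>W\<close> and may miss
    \<open>(s, y)\<close>.\<close>
  then obtain a b where ab: "(a, b) \<in> W" by fast
  then obtain A' B' where "openin T A'" "openin X B'" "a \<in> A'" "b \<in> B'" "A' \<times> B' \<subseteq> W"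
    using W(1)[unfolded openin_prod_topology_alt, rule_format, OF ab] by auto
  then show thesis
    using W(3,4) by (intro that[of A' B']) blast+
qed

text \<open>This is total boundedness of a finite-dimensional cube: rounding values down to
  multiples of \<open>\<delta>\<close> leaves finitely many codes, and \<open>Z\<close> has a
  representative for each code that occurs.\<close>

lemma finite_net_of_bounded_functions:
  fixes F :: "'a \<Rightarrow> 'b \<Rightarrow> real"
  assumes "finite P" "\<delta> > 0" and F: "\<And>p y. p \<in> P \<Longrightarrow> y \<in> Y \<Longrightarrow> F p y \<in> {0..1}"
  obtains Z where "finite Z" "Z \<subseteq> Y"
    "\<forall>y\<in>Y. \<exists>z\<in>Z. \<forall>p\<in>P. \<bar>F p y - F p z\<bar> < \<delta>"
proof -
  \<comment> \<open>Restricting to \<open>P\<close> makes the codes extensional, so that they lie in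
    a finite \<open>PiE\<close> set.\<close>
  define c where "c y = (\<lambda>p\<in>P. \<lfloor>F p y / \<delta>\<rfloor>)" for y
  have "c ` Y \<subseteq> P \<rightarrow>\<^sub>E {0..\<lfloor>1 / \<delta>\<rfloor>}"
    using F \<open>\<delta> > 0\<close> by (auto simp: c_def PiE_iff intro!: floor_mono divide_right_mono)
  then have "finite (c ` Y)"
    using finite_PiE[OF \<open>finite P\<close>, of "\<lambda>_. {0..\<lfloor>1 / \<delta>\<rfloor>}"] by (simp add: finite_subset)
  then obtain Z where Z: "Z \<subseteq> Y" "finite Z" "c ` Y = c ` Z"
    using finite_subset_image[of "c ` Y" c Y] by blast
  have "\<exists>z\<in>Z. \<forall>p\<in>P. \<bar>F p y - F p z\<bar> < \<delta>" if "y \<in> Y" for y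
  proof -
    have "c y \<in> c ` Z" using that by (simp flip: Z(3))
    then obtain z where z: "z \<in> Z" "c y = c z" by blast
    have "\<bar>F p y - F p z\<bar> < \<delta>" if "p \<in> P" for p
    proof -
      have "\<lfloor>F p y / \<delta>\<rfloor> = \<lfloor>F p z / \<delta>\<rfloor>"
        using z(2) that unfolding c_def by (metis restrict_apply')
      then have "\<bar>F p y / \<delta> - F p z / \<delta>\<bar> < 1" by linarith
      then show ?thesis
        using \<open>\<delta> > 0\<close> by (simp add: diff_divide_distrib[symmetric] abs_divide)
    qed
    then show ?thesis using z(1) by blast
  qed
  then show thesis using Z that by blast
qed

text \<open>The algebra is stripped off here: the instance used later is
  \<open>F s y = g (\<pi> (s, y))\<close> for a continuous \<open>g\<close> into the unit
  interval.\<close>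

locale separately_quasicontinuous =
  fixes T :: "'s topology" and X :: "'x topology" and F :: "'s \<Rightarrow> 'x \<Rightarrow> real"
  assumes pseudocompact: "pseudocompact_space T" "pseudocompact_space X"
    and completely_regular: "completely_regular_space T" "completely_regular_space X"
    and continuous_right: "s \<in> topspace T \<Longrightarrow> continuous_map X euclideanreal (F s)"
    and continuous_left: "y \<in> topspace X \<Longrightarrow> continuous_map T euclideanreal (\<lambda>s. F s y)"
    and quasicontinuous: "quasicontinuous_map (prod_topology T X) euclideanreal (\<lambda>(s, y). F s y)"
    and range: "s \<in> topspace T \<Longrightarrow> y \<in> topspace X \<Longrightarrow> F s y \<in> {0..1}"
begin

lemma openin_left:
  assumes "openin T A" "finite Z" "Z \<subseteq> topspace X" "\<And>z. z \<in> Z \<Longrightarrow> open (I z)"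
  shows "openin T {s \<in> A. \<forall>z\<in>Z. F s z \<in> I z}"
  using assms(2-)
proof (induction Z)
  case empty
  then show ?case using assms(1) by simp
next
  case (insert z Z)
  have "openin T {s \<in> topspace T. F s z \<in> I z}"
    using insert.prems by (intro openin_continuous_map_preimage[OF continuous_left]) auto
  then have "openin T ({s \<in> A. \<forall>z\<in>Z. F s z \<in> I z} \<inter> {s \<in> topspace T. F s z \<in> I z})"
    using insert by (intro openin_Int) auto
  then show ?case
    using openin_subset[OF assms(1)] by (elim back_subst[of "openin T"]) auto
qed

lemma openin_right:
  assumes "openin X B" "finite P" "P \<subseteq> topspace T" "\<And>p. p \<in> P \<Longrightarrow> open (I p)"
  shows "openin X {y \<in> B. \<forall>p\<in>P. F p y \<in> I p}"
  using assms(2-)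
proof (induction P)
  case empty
  then show ?case using assms(1) by simp
next
  case (insert p P)
  have "openin X {y \<in> topspace X. F p y \<in> I p}"
    using insert.prems by (intro openin_continuous_map_preimage[OF continuous_right]) auto
  then have "openin X ({y \<in> B. \<forall>p\<in>P. F p y \<in> I p} \<inter> {y \<in> topspace X. F p y \<in> I p})"
    using insert by (intro openin_Int) auto
  then show ?case
    using openin_subset[OF assms(1)] by (elim back_subst[of "openin X"]) auto
qed

lemma box:
  assumes "openin T A" "s \<in> A" "openin X B" "y \<in> B" "open G" "F s y \<in> G"
  obtains A' B' where "openin T A'" "A' \<noteq> {}" "A' \<subseteq> A" "openin X B'" "B' \<noteq> {}" "B' \<subseteq> B"
    "\<And>a b. a \<in> A' \<Longrightarrow> b \<in> B' \<Longrightarrow> F a b \<in> G"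
  by (rule quasicontinuous_map_prod_box[OF quasicontinuous assms(1-4), of G])
    (use assms(5,6) in auto)

text \<open>One step of the double-limit construction. Large oscillation is turned into a single
  \<open>\<sigma>\<close> that separates two points which \<open>P\<close> barely distinguishes;
  applying quasicontinuity twice then thickens the two points to open sets \<open>V\<close> and
  \<open>V'\<close>.\<close>

lemma separating_boxes:
  assumes A: "openin T A" "A \<noteq> {}" and P: "finite P" "P \<subseteq> topspace T"
    and "\<delta> > 0" "\<epsilon> > 0"
    and osc: "\<And>A'. openin T A' \<Longrightarrow> A' \<noteq> {} \<Longrightarrow> A' \<subseteq> A \<Longrightarrow>
        \<exists>s\<in>A'. \<exists>s'\<in>A'. \<exists>y\<in>topspace X. F s y - F s' y > 8 * \<epsilon>"
  obtains A' V V' a where "openin T A'" "A' \<noteq> {}" "A' \<subseteq> A"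
    "openin X V" "V \<noteq> {}" "openin X V'" "V' \<noteq> {}"
    "\<And>p y y'. p \<in> P \<Longrightarrow> y \<in> V \<Longrightarrow> y' \<in> V' \<Longrightarrow> \<bar>F p y - F p y'\<bar> < \<delta>"
    "\<And>s y. s \<in> A' \<Longrightarrow> y \<in> V \<Longrightarrow> a + 2 * \<epsilon> < F s y"
    "\<And>s y. s \<in> A' \<Longrightarrow> y \<in> V' \<Longrightarrow> F s y < a"
    "a \<in> {0..2 + \<epsilon>}"
proof -
  have AT: "A \<subseteq> topspace T" using A(1) openin_subset by blast
  have "\<delta> / 3 > 0" using \<open>\<delta> > 0\<close> by simp
  moreover have "F p y \<in> {0..1}" if "p \<in> P" "y \<in> topspace X" for p y
    using that P(2) range by blast
  ultimately obtain Z where Z: "finite Z" "Z \<subseteq> topspace X"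
      and net: "\<forall>y\<in>topspace X. \<exists>z\<in>Z. \<forall>p\<in>P. \<bar>F p y - F p z\<bar> < \<delta> / 3"
    by (rule finite_net_of_bounded_functions[OF P(1)])
  obtain u where u: "u \<in> A" using A(2) by blast
  \<comment> \<open>On \<open>A1\<close> the values at each net point vary by less than
    \<open>2 * \<epsilon>\<close>, so the oscillation found next cannot come from
    \<open>Z\<close>.\<close>
  define A1 where "A1 = {s \<in> A. \<forall>z\<in>Z. F s z \<in> ball (F u z) \<epsilon>}"
  have "openin T A1" unfolding A1_def using A(1) Z by (intro openin_left) auto
  moreover have "u \<in> A1" "A1 \<subseteq> A" using u \<open>\<epsilon> > 0\<close> by (auto simp: A1_def)
  ultimately obtain s s' y where s: "s \<in> A1" "s' \<in> A1" "y \<in> topspace X" "F s y - F s' y > 8 * \<epsilon>"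
    using osc[of A1] by blast
  obtain z where z: "z \<in> Z" "\<And>p. p \<in> P \<Longrightarrow> \<bar>F p y - F p z\<bar> < \<delta> / 3" using net s(3) by blast
  have zX: "z \<in> topspace X" using z(1) Z by blast
  have "\<bar>F s z - F u z\<bar> < \<epsilon>" "\<bar>F s' z - F u z\<bar> < \<epsilon>"
    using s z(1) by (auto simp: A1_def dist_real_def abs_minus_commute)
  \<comment> \<open>Going from \<open>F s y\<close> through \<open>F s z\<close> and
    \<open>F s' z\<close> to \<open>F s' y\<close>, the middle difference is below
    \<open>2 * \<epsilon>\<close>; the outer two share more than \<open>6 * \<epsilon>\<close>. The
    cases give \<open>\<sigma> = s\<close> with points \<open>y\<close>, \<open>z\<close>, or
    \<open>\<sigma> = s'\<close> with points \<open>z\<close>, \<open>y\<close>.\<close>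
  then have "F s y - F s z > 3 * \<epsilon> \<or> F s' z - F s' y > 3 * \<epsilon>"
    using s(4) by linarith
  then obtain \<sigma> y1 y2 where \<sigma>: "\<sigma> \<in> A" "y1 \<in> topspace X" "y2 \<in> topspace X"
      "F \<sigma> y1 - F \<sigma> y2 > 3 * \<epsilon>" "\<And>p. p \<in> P \<Longrightarrow> \<bar>F p y1 - F p y2\<bar> < \<delta> / 3"
    using s(1-3) zX z(2) \<open>A1 \<subseteq> A\<close> abs_minus_commute by (metis subsetD)
  define a where "a = F \<sigma> y2 + \<epsilon>"
  define B where "B w = {y \<in> topspace X. \<forall>p\<in>P. F p y \<in> ball (F p w) (\<delta> / 3)}" for w
  have B: "openin X (B w)" for w
    unfolding B_def using P by (intro openin_right) auto
  have B': "w \<in> topspace X \<Longrightarrow> w \<in> B w" for w using \<open>\<delta> > 0\<close> by (simp add: B_def)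
  \<comment> \<open>The first box may lose \<open>\<sigma>\<close>. Taking it inside the set where
    \<open>F s y2 < a\<close> lets any \<open>\<tau>\<close> in \<open>A2\<close> serve as base
    point of the second box.\<close>
  have "openin T {s \<in> A. \<forall>z\<in>{y2}. F s z \<in> {..<a}}"
    using A(1) \<sigma> by (intro openin_left) auto
  then obtain A2 V where A2: "openin T A2" "A2 \<noteq> {}" "A2 \<subseteq> {s \<in> A. \<forall>z\<in>{y2}. F s z \<in> {..<a}}"
      and V: "openin X V" "V \<noteq> {}" "V \<subseteq> B y1" "\<And>s y. s \<in> A2 \<Longrightarrow> y \<in> V \<Longrightarrow> F s y \<in> {a + 2 * \<epsilon><..}"
    by (rule box[where s = \<sigma> and y = y1 and G = "{a + 2 * \<epsilon><..}", OF _ _ B B'])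
      (use \<sigma> \<open>\<epsilon> > 0\<close> in \<open>auto simp: a_def\<close>)
  obtain \<tau> where \<tau>: "\<tau> \<in> A2" using A2(2) by blast
  obtain A3 V' where A3: "openin T A3" "A3 \<noteq> {}" "A3 \<subseteq> A2"
      and V': "openin X V'" "V' \<noteq> {}" "V' \<subseteq> B y2" "\<And>s y. s \<in> A3 \<Longrightarrow> y \<in> V' \<Longrightarrow> F s y \<in> {..<a}"
    by (rule box[where s = \<tau> and y = y2 and G = "{..<a}", OF A2(1) \<tau> B B']) (use \<sigma> \<tau> A2(3) in auto)
  show thesis
  proof (rule that[OF A3(1,2) _ V(1,2) V'(1,2)])
    show "\<bar>F p y - F p y'\<bar> < \<delta>" if "p \<in> P" "y \<in> V" "y' \<in> V'" for p y y'
    proof -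
      have "\<bar>F p y1 - F p y\<bar> < \<delta> / 3" "\<bar>F p y2 - F p y'\<bar> < \<delta> / 3"
        using that V(3) V'(3) by (auto simp: B_def dist_real_def)
      then show ?thesis using \<sigma>(5)[OF that(1)] by linarith
    qed
    show "a \<in> {0..2 + \<epsilon>}"
      using range[of \<sigma> y2] \<sigma> AT \<open>\<epsilon> > 0\<close> by (auto simp: a_def)
    show "A3 \<subseteq> A" using A2(3) A3(3) by blast
    show "a + 2 * \<epsilon> < F s y" if "s \<in> A3" "y \<in> V" for s y
      using V(4)[of s y] A3(3) that by auto
    show "F s y < a" if "s \<in> A3" "y \<in> V'" for s y
      using V'(4)[of s y] that by auto
  qed
qed

text \<open>Otherwise \<open>separating_boxes\<close> can be iterated with \<open>P\<close> the set
  of earlier points \<open>s i\<close>. The points \<open>s i\<close> do not distinguish the limits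
  \<open>y\<close> and \<open>y'\<close> of the \<open>V n\<close> and \<open>V' n\<close>, whereas
  a limit \<open>t\<close> of neighbourhoods of the \<open>s i\<close> inherits their separation
  from the sets \<open>A n\<close>.\<close>

lemma nonempty_open_small_oscillation:
  assumes U: "openin T U" "U \<noteq> {}" and "\<eta> > 0"
  obtains A where "openin T A" "A \<noteq> {}" "A \<subseteq> U"
    "\<And>s s' y. s \<in> A \<Longrightarrow> s' \<in> A \<Longrightarrow> y \<in> topspace X \<Longrightarrow> F s y - F s' y \<le> \<eta>"
proof (rule ccontr)
  note small = that
  assume neg: "\<not> thesis"
  define \<epsilon> where "\<epsilon> = \<eta> / 8"
  have "\<epsilon> > 0" using \<open>\<eta> > 0\<close> by (simp add: \<epsilon>_def)
  have osc: "\<exists>s\<in>A. \<exists>s'\<in>A. \<exists>y\<in>topspace X. F s y - F s' y > 8 * \<epsilon>"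
    if A: "openin T A" "A \<noteq> {}" "A \<subseteq> U" for A
  proof (rule ccontr)
    assume "\<not> ?thesis"
    then have "F s y - F s' y \<le> \<eta>" if "s \<in> A" "s' \<in> A" "y \<in> topspace X" for s s' y
      using that by (force simp: \<epsilon>_def)
    then show False using neg small[OF A] by blast
  qed
  \<comment> \<open>\<open>good f n r\<close> says that stage \<open>r\<close> may follow the
    history of \<open>f\<close> below \<open>n\<close>; it reads \<open>f\<close> only there, as the
    recursive choice demands.\<close>
  define good where "good f n r \<longleftrightarrow> (case r of (A, s, V, V', a) \<Rightarrow>
      openin T A \<and> s \<in> A \<and> A \<subseteq> U \<and> (\<forall>i<n. A \<subseteq> fst (f i)) \<and>
      openin X V \<and> V \<noteq> {} \<and> openin X V' \<and> V' \<noteq> {} \<and>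
      (\<forall>i<n. \<forall>y\<in>V. \<forall>y'\<in>V'. \<bar>F (fst (snd (f i))) y - F (fst (snd (f i))) y'\<bar> < inverse (real (Suc n))) \<and>
      (\<forall>s\<in>A. \<forall>y\<in>V. a + 2 * \<epsilon> < F s y) \<and> (\<forall>s\<in>A. \<forall>y\<in>V'. F s y < a) \<and> a \<in> {0..2 + \<epsilon>})"
    for f :: "nat \<Rightarrow> 's set \<times> 's \<times> 'x set \<times> 'x set \<times> real" and n r
  have "\<exists>f. \<forall>n. good f n (f n)"
  proof (rule dependent_wellorder_choice)
    show "good f n r = good g n r" if "\<And>i. i < n \<Longrightarrow> f i = g i" for r f g n
      using that by (simp add: good_def cong: conj_cong)
  next
    fix n f assume IH: "\<And>i. i < n \<Longrightarrow> good f i (f i)"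
    have IH': "openin T (fst (f i))" "fst (snd (f i)) \<in> fst (f i)" "fst (f i) \<subseteq> U"
        "\<And>j. j < i \<Longrightarrow> fst (f i) \<subseteq> fst (f j)" if "i < n" for i
      using IH[OF that] by (auto simp: good_def split: prod.splits)
    obtain A where A: "openin T A" "A \<noteq> {}" "A \<subseteq> U" "\<And>i. i < n \<Longrightarrow> A \<subseteq> fst (f i)"
    proof (cases n)
      case 0
      then show thesis using U by (intro that[of U]) auto
    next
      case (Suc m)
      have "fst (f m) \<subseteq> fst (f i)" if "i < n" for i
        using IH'(4)[of m i] that Suc by (cases "i = m") auto
      then show thesis using IH'[of m] Suc by (intro that[of "fst (f m)"]) auto
    qed
    have P: "finite ((\<lambda>i. fst (snd (f i))) ` {..<n})" "(\<lambda>i. fst (snd (f i))) ` {..<n} \<subseteq> topspace T"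
      using IH' openin_subset by blast+
    have osc_A: "\<exists>s\<in>B. \<exists>s'\<in>B. \<exists>y\<in>topspace X. F s y - F s' y > 8 * \<epsilon>"
      if "openin T B" "B \<noteq> {}" "B \<subseteq> A" for B
      using osc that A(3) by blast
    have pos: "inverse (real (Suc n)) > 0" by simp
    show "\<exists>r. good f n r"
    proof (rule separating_boxes[OF A(1,2) P pos \<open>\<epsilon> > 0\<close> osc_A])
      fix A' V V' a
      assume *: "openin T A'" "A' \<noteq> {}" "A' \<subseteq> A"
        "openin X V" "V \<noteq> {}" "openin X V'" "V' \<noteq> {}"
        "\<And>p y y'. p \<in> (\<lambda>i. fst (snd (f i))) ` {..<n} \<Longrightarrow> y \<in> V \<Longrightarrow> y' \<in> V' \<Longrightarrow>
          \<bar>F p y - F p y'\<bar> < inverse (real (Suc n))"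
        "\<And>s y. s \<in> A' \<Longrightarrow> y \<in> V \<Longrightarrow> a + 2 * \<epsilon> < F s y"
        "\<And>s y. s \<in> A' \<Longrightarrow> y \<in> V' \<Longrightarrow> F s y < a" "a \<in> {0..2 + \<epsilon>}"
      obtain s where "s \<in> A'" using *(2) by blast
      then have "good f n (A', s, V, V', a)"
        unfolding good_def prod.case using * A(3,4) by (intro conjI allI impI ballI) blast+
      then show ?thesis by blast
    qed
  qed
  then obtain f where f: "\<And>n. good f n (f n)" by blast
  define A where "A n = fst (f n)" for n
  define s where "s n = fst (snd (f n))" for n
  define V where "V n = fst (snd (snd (f n)))" for n
  define V' where "V' n = fst (snd (snd (snd (f n))))" for n
  define a where "a n = snd (snd (snd (snd (f n))))" for n
  have A: "openin T (A n)" "s n \<in> A n" "A n \<subseteq> topspace T" and V: "openin X (V n)" "V n \<noteq> {}" "V n \<subseteq> topspace X"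
    and V': "openin X (V' n)" "V' n \<noteq> {}" "V' n \<subseteq> topspace X"
    and a: "a n \<in> {0..2 + \<epsilon>}" for n
    using f[of n] openin_subset
    by (auto simp: good_def A_def s_def V_def V'_def a_def split: prod.splits)
  have decr: "A n \<subseteq> A i" if "i \<le> n" for i n
    using f[of n] that
    by (cases "i = n") (auto simp: good_def A_def split: prod.splits)
  have close: "\<bar>F (s i) y - F (s i) y'\<bar> < inverse (real (Suc n))"
    if "i < n" "y \<in> V n" "y' \<in> V' n" for i n y y'
    using f[of n] that by (auto simp: good_def s_def V_def V'_def split: prod.splits)
  have hi: "a n + 2 * \<epsilon> < F t y" if "t \<in> A n" "y \<in> V n" for n t y
    using f[of n] that by (auto simp: good_def A_def V_def a_def split: prod.splits)
  have lo: "F t y < a n" if "t \<in> A n" "y \<in> V' n" for n t y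
    using f[of n] that by (auto simp: good_def A_def V'_def a_def split: prod.splits)

  \<comment> \<open>The levels \<open>a n\<close> lie in a compact interval, so a subsequence
    converges; dropping its first \<open>k0\<close> terms puts every \<open>a (r k)\<close> within
    \<open>\<epsilon> / 2\<close> of \<open>\<alpha>\<close>.\<close>
  obtain \<alpha> r0 where r0: "strict_mono (r0 :: nat \<Rightarrow> nat)" "(a \<circ> r0) \<longlonglongrightarrow> \<alpha>"
    using compact_Icc[of 0 "2 + \<epsilon>"] a unfolding compact_eq_seq_compact_metric seq_compact_def by metis
  obtain k0 where k0: "\<And>k. k \<ge> k0 \<Longrightarrow> \<bar>a (r0 k) - \<alpha>\<bar> < \<epsilon> / 2"
    using r0(2) \<open>\<epsilon> > 0\<close> unfolding LIMSEQ_def by (metis comp_apply dist_real_def half_gt_zero)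
  define r where "r k = r0 (k + k0)" for k
  have r: "k \<le> r k" "\<bar>a (r k) - \<alpha>\<bar> < \<epsilon> / 2" for k
    using k0[of "k + k0"] seq_suble[OF r0(1), of "k + k0"] by (auto simp: r_def)
  obtain y where y: "cluster_point_of_sets X (\<lambda>k. V (r k)) y"
    using pseudocompact_cluster_point_of_sets[OF pseudocompact(2) completely_regular(2)] V by metis
  have yX: "y \<in> topspace X" using y by (rule cluster_point_of_sets_in_topspace)
  \<comment> \<open>Cluster points chosen independently for \<open>V\<close> and \<open>V'\<close>
    could come from unrelated indices. Hence \<open>y'\<close> is sought along indices
    \<open>r (q k)\<close> at which \<open>V\<close> has a point \<open>z k\<close> that the first
    \<open>k\<close> of the \<open>s i\<close> hardly tell from \<open>y\<close>.\<close>
  have "\<exists>m\<ge>k. \<exists>z\<in>V (r m). \<forall>i<k. \<bar>F (s i) z - F (s i) y\<bar> < inverse (real (Suc k))" for k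
  proof -
    let ?N = "{z \<in> topspace X. \<forall>p \<in> s ` {..<k}. F p z \<in> ball (F p y) (inverse (real (Suc k)))}"
    have "openin X ?N" using A by (intro openin_right) auto
    moreover have "y \<in> ?N" using yX by simp
    ultimately obtain m z where "m \<ge> k" "z \<in> ?N" "z \<in> V (r m)"
      by (rule cluster_point_of_setsE[OF y])
    then show ?thesis
      by (auto simp: dist_real_def abs_minus_commute intro!: exI[of _ m] bexI[of _ z])
  qed
  then obtain q z where q: "\<And>k. q k \<ge> k" "\<And>k. z k \<in> V (r (q k))"
      "\<And>i k. i < k \<Longrightarrow> \<bar>F (s i) (z k) - F (s i) y\<bar> < inverse (real (Suc k))"
    by metis
  obtain y' where y': "cluster_point_of_sets X (\<lambda>k. V' (r (q k))) y'"
    using pseudocompact_cluster_point_of_sets[OF pseudocompact(2) completely_regular(2)] V' by metis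
  have y'X: "y' \<in> topspace X" using y' by (rule cluster_point_of_sets_in_topspace)
  \<comment> \<open>For late \<open>k\<close> and \<open>x\<close> in \<open>V' (r (q k))\<close>,
    \<open>F (s i) x\<close> is close to \<open>F (s i) (z k)\<close> and that to
    \<open>F (s i) y\<close>. The bound \<open>Suc i\<close> on \<open>k\<close> makes
    \<open>s i\<close> one of the earlier points in both comparisons.\<close>
  have near: "\<bar>F (s i) y' - F (s i) y\<bar> \<le> \<epsilon> / 2" for i
  proof -
    obtain k0 where k0: "inverse (real (Suc k0)) < \<epsilon> / 4"
      using reals_Archimedean[of "\<epsilon> / 4"] \<open>\<epsilon> > 0\<close> by auto
    have *: "\<bar>F (s i) x - F (s i) y\<bar> \<le> \<epsilon> / 2" if "k \<ge> max k0 (Suc i)" "x \<in> V' (r (q k))" for k x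
    proof -
      have le: "k \<le> r (q k)" using q(1) r(1) order_trans by blast
      then have "\<bar>F (s i) (z k) - F (s i) x\<bar> < inverse (real (Suc (r (q k))))"
        using close q(2) that by auto
      also have "\<dots> \<le> inverse (real (Suc k0))" using le that by (intro le_imp_inverse_le) auto
      finally have "\<bar>F (s i) (z k) - F (s i) x\<bar> < \<epsilon> / 4" using k0 by linarith
      moreover have "inverse (real (Suc k)) \<le> inverse (real (Suc k0))"
        using that by (intro le_imp_inverse_le) auto
      moreover have "\<bar>F (s i) (z k) - F (s i) y\<bar> < inverse (real (Suc k))"
        using q(3) that by auto
      ultimately show ?thesis using k0 by linarith
    qed
    have "s i \<in> topspace T" using A by blast
    then have "continuous_map X euclideanreal (\<lambda>x. \<bar>F (s i) x - F (s i) y\<bar>)"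
      by (intro continuous_intros continuous_right) auto
    then show ?thesis
      using * by (rule cluster_point_of_sets_le[OF y'])
  qed
  \<comment> \<open>Accumulation is available for open sets only, so \<open>s i\<close> is thickened
    inside \<open>A i\<close>; the slack from 1/2 to 3/4 leaves room for this.\<close>
  define W where "W i = {t \<in> A i. F t y' - F t y \<in> {- 3/4 * \<epsilon><..<3/4 * \<epsilon>}}" for i
  have cW: "continuous_map T euclideanreal (\<lambda>t. F t y' - F t y)"
    using yX y'X by (intro continuous_intros continuous_left)
  have "openin T (W i)" for i
  proof -
    have "openin T (A i \<inter> {t \<in> topspace T. F t y' - F t y \<in> {- 3/4 * \<epsilon><..<3/4 * \<epsilon>}})"
      using A by (intro openin_Int openin_continuous_map_preimage[OF cW]) auto
    then show ?thesis
      using A(3) by (elim back_subst[of "openin T"]) (auto simp: W_def)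
  qed
  moreover have "s i \<in> W i" for i
  proof -
    have "- 3/4 * \<epsilon> < F (s i) y' - F (s i) y" "F (s i) y' - F (s i) y < 3/4 * \<epsilon>"
      using near[of i] \<open>\<epsilon> > 0\<close> by linarith+
    then show ?thesis using A(2) by (simp add: W_def)
  qed
  ultimately obtain t where t: "cluster_point_of_sets T W t"
    using pseudocompact_cluster_point_of_sets[OF pseudocompact(1) completely_regular(1)]
    by (metis empty_iff)
  have tT: "t \<in> topspace T" using t by (rule cluster_point_of_sets_in_topspace)
  have WA: "u \<in> A n" if "u \<in> W i" "n \<le> i" for u i n
    using that decr unfolding W_def by blast
  \<comment> \<open>The point \<open>t\<close> need not lie in any \<open>A n\<close>, but late
    \<open>W i\<close> are inside \<open>A n\<close>, so the bounds on \<open>A n\<close> survive as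
    weak inequalities at \<open>t\<close>. They force a gap of at least \<open>\<epsilon>\<close>
    between \<open>F t y\<close> and \<open>F t y'\<close>, against \<open>3/4 * \<epsilon>\<close>
    here.\<close>
  have "- 3/4 * \<epsilon> \<le> F t y' - F t y"
    by (rule cluster_point_of_sets_ge[OF t cW, of 0]) (auto simp: W_def)
  moreover have "\<alpha> + 3 / 2 * \<epsilon> \<le> F t y"
  proof (rule cluster_point_of_sets_ge[OF y continuous_right[OF tT], of 0])
    fix k x assume x: "x \<in> V (r k)"
    have "a (r k) + 2 * \<epsilon> \<le> F t x"
      using x V(3) hi[OF WA x]
      by (intro cluster_point_of_sets_ge[OF t continuous_left, of _ "r k"]) (auto intro: less_imp_le)
    then show "\<alpha> + 3 / 2 * \<epsilon> \<le> F t x" using r(2)[of k] by linarith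
  qed
  moreover have "F t y' \<le> \<alpha> + 1 / 2 * \<epsilon>"
  proof (rule cluster_point_of_sets_le[OF y' continuous_right[OF tT], of 0])
    fix k x assume x: "x \<in> V' (r (q k))"
    have "F t x \<le> a (r (q k))"
      using x V'(3) lo[OF WA x]
      by (intro cluster_point_of_sets_le[OF t continuous_left, of _ "r (q k)"]) (auto intro: less_imp_le)
    then show "F t x \<le> \<alpha> + 1 / 2 * \<epsilon>" using r(2)[of "q k"] by linarith
  qed
  ultimately show False using \<open>\<epsilon> > 0\<close> by linarith
qed

end

section \<open>Joint continuity of the action at the identity and at units\<close>

lemma quasicontinuous_map_compose_continuous_map:
  assumes f: "quasicontinuous_map A B f" and g: "continuous_map B C g"
  shows "quasicontinuous_map A C (g \<circ> f)"
  unfolding quasicontinuous_map_def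
proof (intro conjI ballI allI impI)
  have fB: "f \<in> topspace A \<rightarrow> topspace B" using f by (simp add: quasicontinuous_map_def)
  then show "g \<circ> f \<in> topspace A \<rightarrow> topspace C"
    using continuous_map_funspace[OF g] by auto
  fix a V U assume a: "a \<in> topspace A"
    and VU: "openin C V \<and> (g \<circ> f) a \<in> V \<and> openin A U \<and> a \<in> U"
  let ?V = "{b \<in> topspace B. g b \<in> V}"
  have "openin B ?V" using g VU by (intro openin_continuous_map_preimage) auto
  moreover have "f a \<in> ?V" using VU a fB by auto
  ultimately have "\<exists>W. openin A W \<and> W \<noteq> {} \<and> W \<subseteq> U \<and> f ` W \<subseteq> ?V"
    using f a VU unfolding quasicontinuous_map_def by blast
  then show "\<exists>W. openin A W \<and> W \<noteq> {} \<and> W \<subseteq> U \<and> (g \<circ> f) ` W \<subseteq> V"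
    by (auto simp: image_subset_iff)
qed

text \<open>If \<open>s\<close> lies in an open \<open>U\<close>, so does the product of
  \<open>s\<close> and \<open>t\<close> for \<open>t\<close> near the identity. Small oscillation on
  \<open>U\<close> thus bounds \<open>F s (\<pi> (t, v))\<close> by \<open>F s v\<close> plus a
  small error, although \<open>\<pi> (t, v)\<close> may be far from
  \<open>\<pi> (\<one>, x0)\<close>.\<close>

lemma action_topcontinuous_at_one:
  fixes S :: "('s, 'm) monoid_scheme"
    and T :: "'s topology"
    and X :: "'x topology"
    and \<pi> :: "'s \<times> 'x \<Rightarrow> 'x"
  assumes S: "right_topological_monoid S T"
    and T: "pseudocompact_space T" "completely_regular_space T"
    and X: "pseudocompact_space X" "completely_regular_space X"
    and act: "semigroup_action S (topspace X) \<pi>"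
    and sep: "separately_continuous_map T X X \<pi>"
    and qc: "quasicontinuous_map (prod_topology T X) X \<pi>"
    and x0: "x0 \<in> topspace X"
  shows "topcontinuous_at (prod_topology T X) X \<pi> (\<one>\<^bsub>S\<^esub>, x0)"
proof -
  interpret S: Group.monoid S
    using S by (simp add: right_topological_monoid_def)
  have TS: "topspace T = carrier S" using S by (simp add: right_topological_monoid_def)
  have transl: "s \<in> carrier S \<Longrightarrow> continuous_map T T (\<lambda>t. s \<otimes>\<^bsub>S\<^esub> t)" for s
    using S by (simp add: right_topological_monoid_def)
  have \<pi>X: "\<pi> (s, x) \<in> topspace X" if "s \<in> carrier S" "x \<in> topspace X" for s x
    using act that by (auto simp: semigroup_action_def)
  have \<pi>mult: "\<pi> (s, \<pi> (t, x)) = \<pi> (s \<otimes>\<^bsub>S\<^esub> t, x)"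
    if "s \<in> carrier S" "t \<in> carrier S" "x \<in> topspace X" for s t x
    using act that by (auto simp: semigroup_action_def)
  let ?e = "\<one>\<^bsub>S\<^esub>"
  have "\<exists>U. openin (prod_topology T X) U \<and> (?e, x0) \<in> U \<and> (\<forall>p\<in>U. \<pi> p \<in> V)"
    if V: "openin X V" "\<pi> (?e, x0) \<in> V" for V
  proof (rule ccontr)
    assume neg: "\<nexists>U. openin (prod_topology T X) U \<and> (?e, x0) \<in> U \<and> (\<forall>p\<in>U. \<pi> p \<in> V)"
    have escape: "\<exists>t\<in>A. \<exists>v\<in>B. \<pi> (t, v) \<notin> V"
      if "openin T A" "?e \<in> A" "openin X B" "x0 \<in> B" for A B
    proof -
      have "openin (prod_topology T X) (A \<times> B)" "(?e, x0) \<in> A \<times> B"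
        using that by (auto simp: openin_prod_Times_iff)
      then show ?thesis using neg by blast
    qed
    have "closedin X (topspace X - V)" "\<pi> (?e, x0) \<in> topspace X - (topspace X - V)"
      using V openin_subset by fastforce+
    then obtain g where g: "continuous_map X (top_of_set {0..1::real}) g" "g (\<pi> (?e, x0)) = 0"
        "g ` (topspace X - V) \<subseteq> {1}"
      using X(2) unfolding completely_regular_space_def by metis
    have g': "continuous_map X euclideanreal g" "g \<in> topspace X \<rightarrow> {0..1}"
      using g(1) by (auto simp: continuous_map_in_subtopology)
    define F where "F s y = g (\<pi> (s, y))" for s y
    interpret F: separately_quasicontinuous T X F
    proof
      show "continuous_map X euclideanreal (F s)" if "s \<in> topspace T" for s
        using continuous_map_compose[OF _ g'(1), of X "\<lambda>y. \<pi> (s, y)"] sep that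
        by (simp add: separately_continuous_map_def F_def[abs_def] o_def)
      show "continuous_map T euclideanreal (\<lambda>s. F s y)" if "y \<in> topspace X" for y
        using continuous_map_compose[OF _ g'(1), of T "\<lambda>s. \<pi> (s, y)"] sep that
        by (simp add: separately_continuous_map_def F_def[abs_def] o_def)
      have "g \<circ> \<pi> = (\<lambda>(s, y). F s y)" by (auto simp: F_def)
      then show "quasicontinuous_map (prod_topology T X) euclideanreal (\<lambda>(s, y). F s y)"
        using quasicontinuous_map_compose_continuous_map[OF qc g'(1)] by simp
      show "F s y \<in> {0..1}" if "s \<in> topspace T" "y \<in> topspace X" for s y
        using g'(2) \<pi>X that by (auto simp: F_def TS)
    qed (use T X in auto)
    have F_mult: "F s (\<pi> (t, x)) = F (s \<otimes>\<^bsub>S\<^esub> t) x"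
      if "s \<in> carrier S" "t \<in> carrier S" "x \<in> topspace X" for s t x
      using that by (simp add: F_def \<pi>mult)
    \<comment> \<open>A stage is \<open>(s, U, y)\<close>. The last condition is what lets the next
      stage find points with large values at \<open>y\<close>, as it holds at the identity.\<close>
    define good where "good f n r \<longleftrightarrow> (case r of (s, U, y) \<Rightarrow>
        openin T U \<and> s \<in> U \<and> y \<in> topspace X \<and>
        (\<forall>a\<in>U. \<forall>b\<in>U. \<forall>y\<in>topspace X. F a y - F b y \<le> 1/8) \<and> F s x0 < 1/8 \<and>
        (\<forall>i<n. F s (snd (snd (f i))) > 7/8) \<and> (\<forall>i<n. F (fst (f i)) y < 1/4) \<and>
        F s y < 1/4 \<and> F ?e y = 1)"
      for f :: "nat \<Rightarrow> 's \<times> 's set \<times> 'x" and n r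
    have "\<exists>f. \<forall>n. good f n (f n)"
    proof (rule dependent_wellorder_choice)
      show "good f n r = good g n r" if "\<And>i. i < n \<Longrightarrow> f i = g i" for r f g n
        using that by (simp add: good_def cong: conj_cong)
    next
      fix n f assume IH: "\<And>i. i < n \<Longrightarrow> good f i (f i)"
      define s where "s i = fst (f i)" for i
      define U where "U i = fst (snd (f i))" for i
      define y where "y i = snd (snd (f i))" for i
      have prev: "openin T (U i)" "s i \<in> U i" "y i \<in> topspace X"
          "\<And>a b x. a \<in> U i \<Longrightarrow> b \<in> U i \<Longrightarrow> x \<in> topspace X \<Longrightarrow> F a x - F b x \<le> 1/8"
          "F (s i) x0 < 1/8" "F ?e (y i) = 1" if "i < n" for i
        using IH[OF that] by (auto simp: good_def s_def U_def y_def split: prod.splits)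
      \<comment> \<open>Both sets impose open conditions that hold at the identity. The subset
        \<open>U'\<close> found in \<open>A2\<close> may miss the identity but keeps these
        conditions.\<close>
      define A1 where "A1 = {a \<in> topspace T. \<forall>z\<in>{x0}. F a z \<in> {..<1/8}}"
      define A2 where "A2 = {a \<in> A1. \<forall>z\<in>y ` {..<n}. F a z \<in> {7/8<..}}"
      have "openin T A1" unfolding A1_def using x0 by (intro F.openin_left) auto
      then have "openin T A2" unfolding A2_def using prev(3) by (intro F.openin_left) auto
      moreover have "?e \<in> A2"
        using g(2) prev(6) by (auto simp: A2_def A1_def F_def TS)
      ultimately obtain U' where U': "openin T U'" "U' \<noteq> {}" "U' \<subseteq> A2"
          "\<And>a b x. a \<in> U' \<Longrightarrow> b \<in> U' \<Longrightarrow> x \<in> topspace X \<Longrightarrow> F a x - F b x \<le> 1/8"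
        using F.nonempty_open_small_oscillation[of A2 "1/8"]
        by (metis empty_iff zero_less_divide_1_iff zero_less_numeral)
      then obtain s' where s': "s' \<in> U'" by blast
      \<comment> \<open>The new pair joins the old ones, so the new \<open>y\<close> is small
        against all \<open>i \<le> n\<close>, while large values are required only for
        \<open>i < n\<close>.\<close>
      define H where "H = insert (s', U') ((\<lambda>i. (s i, U i)) ` {..<n})"
      have s'F: "F s' x0 < 1/8" "\<And>i. i < n \<Longrightarrow> F s' (y i) > 7/8"
        using s' U'(3) by (auto simp: A2_def A1_def)
      have H: "openin T (snd h)" "fst h \<in> snd h" "F (fst h) x0 < 1/8"
          "\<And>a b x. a \<in> snd h \<Longrightarrow> b \<in> snd h \<Longrightarrow> x \<in> topspace X \<Longrightarrow> F a x - F b x \<le> 1/8"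
        if "h \<in> H" for h
        using that prev U' s' s'F by (auto simp: H_def)
      have finH: "finite H" by (simp add: H_def)
      have HT: "fst h \<in> carrier S" if "h \<in> H" for h
        using H(1,2)[OF that] openin_subset TS by blast
      \<comment> \<open>Continuity of \<open>t\<close> mapping to \<open>s\<close> times
        \<open>t\<close>, for finitely many fixed \<open>s\<close>, makes this a neighbourhood of
        the identity.\<close>
      define N where "N = (\<Inter>h\<in>H. {t \<in> topspace T. fst h \<otimes>\<^bsub>S\<^esub> t \<in> snd h}) \<inter> topspace T"
      have "openin T N" unfolding N_def
        using finH H(1) HT by (intro openin_INT openin_continuous_map_preimage[OF transl]) auto
      moreover have "?e \<in> N" using H(2) HT by (auto simp: N_def TS)
      moreover define B where "B = {v \<in> topspace X. \<forall>p\<in>fst ` H. F p v \<in> {..<1/8}}"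
      have "openin X B" unfolding B_def using finH HT by (intro F.openin_right) (auto simp: TS)
      moreover have "x0 \<in> B" using H(3) x0 by (auto simp: B_def)
      ultimately obtain t v where tv: "t \<in> N" "v \<in> B" "\<pi> (t, v) \<notin> V" using escape by blast
      then have t: "t \<in> carrier S" and v: "v \<in> topspace X" by (auto simp: N_def B_def TS)
      \<comment> \<open>The identity may act nontrivially on \<open>X\<close>, but it fixes
        \<open>\<pi> (t, v)\<close>, since the identity times \<open>t\<close> is \<open>t\<close>;
        and \<open>g\<close> is 1 off \<open>V\<close>.\<close>
      have "F ?e (\<pi> (t, v)) = 1"
        using F_mult[of ?e t v] t v g(3) tv(3) \<pi>X[OF t v] by (auto simp: F_def)
      moreover have small: "F (fst h) (\<pi> (t, v)) < 1/4" if "h \<in> H" for h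
      proof -
        have "F (fst h \<otimes>\<^bsub>S\<^esub> t) v - F (fst h) v \<le> 1/8"
          using tv(1) that H(2)[OF that] v by (intro H(4)[OF that]) (auto simp: N_def)
        moreover have "F (fst h) v < 1/8" using tv(2) that by (auto simp: B_def)
        ultimately show ?thesis using F_mult[OF HT[OF that] t v] by simp
      qed
      ultimately have "good f n (s', U', \<pi> (t, v))"
        using U' s' s'F small[of "(s', U')"] small[of "(s i, U i)" for i] \<pi>X[OF t v]
        by (auto simp: good_def H_def s_def y_def)
      then show "\<exists>r. good f n r" by blast
    qed
    then obtain f where f: "\<And>n. good f n (f n)" by blast
    define s where "s i = fst (f i)" for i
    define U where "U i = fst (snd (f i))" for i
    define y where "y i = snd (snd (f i))" for i
    have U: "openin T (U i)" "s i \<in> U i" "s i \<in> topspace T" "y i \<in> topspace X"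
        "\<And>a b x. a \<in> U i \<Longrightarrow> b \<in> U i \<Longrightarrow> x \<in> topspace X \<Longrightarrow> F a x - F b x \<le> 1/8" for i
      using f[of i] openin_subset by (auto simp: good_def s_def U_def y_def split: prod.splits)
    have big: "F (s n) (y i) > 7/8" if "i < n" for i n
      using f[of n] that by (auto simp: good_def s_def y_def split: prod.splits)
    have small: "F (s i) (y n) < 1/4" if "i \<le> n" for i n
      using f[of n] that
      by (cases "i = n") (auto simp: good_def s_def y_def split: prod.splits)
    obtain t where t: "cluster_point_of_sets T U t"
      using pseudocompact_cluster_point_of_sets[OF T] U by (metis empty_iff)
    have tT: "t \<in> topspace T" using t by (rule cluster_point_of_sets_in_topspace)
    \<comment> \<open>From stage \<open>Suc i\<close> on, \<open>F (s n) (y i)\<close> exceeds 7/8,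
      and oscillation 1/8 on \<open>U n\<close> leaves 3/4 on all of \<open>U n\<close>, hence at
      \<open>t\<close>.\<close>
    have "3/4 \<le> F t (y i)" for i
    proof (rule cluster_point_of_sets_ge[OF t F.continuous_left[OF U(4)], of "Suc i"])
      fix n u assume "n \<ge> Suc i" "u \<in> U n"
      then show "3/4 \<le> F u (y i)" using big[of i n] U(5)[OF U(2) _ U(4), of u n i] by simp
    qed
    then have ty: "F t (y i) > 5/8" for i by (rule less_le_trans[rotated]) simp
    \<comment> \<open>These are open neighbourhoods of the \<open>y i\<close> that keep
      \<open>F (s j)\<close> small for \<open>j \<le> i\<close> and \<open>F t\<close> large, so a
      cluster point \<open>z\<close> inherits both properties, the first for every
      \<open>j\<close>.\<close>
    define W where
      "W i = {x \<in> {x \<in> topspace X. \<forall>p\<in>s ` {..i}. F p x \<in> {..<1/4}}. \<forall>p\<in>{t}. F p x \<in> {5/8<..}}" for i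
    have "openin X (W i)" for i
      unfolding W_def using U(3) tT by (intro F.openin_right) auto
    moreover have "y i \<in> W i" for i using U(4) small ty by (auto simp: W_def)
    ultimately obtain z where z: "cluster_point_of_sets X W z"
      using pseudocompact_cluster_point_of_sets[OF X] by (metis empty_iff)
    have zX: "z \<in> topspace X" using z by (rule cluster_point_of_sets_in_topspace)
    have Fz: "F (s j) z \<le> 1/4" for j
      by (rule cluster_point_of_sets_le[OF z F.continuous_right[OF U(3)], of j])
        (auto simp: W_def less_imp_le)
    \<comment> \<open>Small oscillation spreads the bound 1/4 at \<open>s j\<close> to 3/8 on the
      whole of \<open>U j\<close>; it therefore reaches \<open>t\<close>, where \<open>F t z\<close>
      is at least 5/8.\<close>
    have "F u z \<le> 3/8" if "u \<in> U j" for u j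
      using U(5)[OF that U(2) zX] Fz[of j] by linarith
    then have "F t z \<le> 3/8"
      by (intro cluster_point_of_sets_le[OF t F.continuous_left[OF zX], of 0])
    moreover have "5/8 \<le> F t z"
      by (rule cluster_point_of_sets_ge[OF z F.continuous_right[OF tT], of 0])
        (auto simp: W_def)
    ultimately show False by simp
  qed
  then show ?thesis
    using x0 \<pi>X unfolding topcontinuous_at_def by (auto simp: TS)
qed

theorem corollary3p5:
  fixes S :: "('s, 'm) monoid_scheme"
    and T :: "'s topology"
    and X :: "'x topology"
    and \<pi> :: "'s \<times> 'x \<Rightarrow> 'x"
  assumes "right_topological_monoid S T"
    and "pseudocompact_space T" and "Tychonoff_space T"
    and "pseudocompact_space X" and "Tychonoff_space X"
    and "semigroup_action S (topspace X) \<pi>"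
    and "separately_continuous_map T X X \<pi>"
    and "quasicontinuous_map (prod_topology T X) X \<pi>"
  shows "\<forall>u \<in> Units S. \<forall>x \<in> topspace X. topcontinuous_at (prod_topology T X) X \<pi> (u, x)"
proof (intro ballI)
  fix u x assume u: "u \<in> Units S" and x: "x \<in> topspace X"
  interpret S: Group.monoid S
    using assms(1) by (simp add: right_topological_monoid_def)
  have TS: "topspace T = carrier S" using assms(1) by (simp add: right_topological_monoid_def)
  let ?u' = "inv\<^bsub>S\<^esub> u"
  have uS: "u \<in> carrier S" "?u' \<in> carrier S" using u by auto
  have \<pi>X: "\<pi> \<in> carrier S \<times> topspace X \<rightarrow> topspace X"
    and \<pi>mult: "\<pi> (u, \<pi> (s, y)) = \<pi> (u \<otimes>\<^bsub>S\<^esub> s, y)" if "s \<in> carrier S" "y \<in> topspace X" for s y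
    using assms(6) uS that by (auto simp: semigroup_action_def)
  have at1: "topcontinuous_at (prod_topology T X) X \<pi> (\<one>\<^bsub>S\<^esub>, x)"
    using assms x by (intro action_topcontinuous_at_one[where S = S]) (auto simp: Tychonoff_space_def)
  show "topcontinuous_at (prod_topology T X) X \<pi> (u, x)"
    unfolding topcontinuous_at_def
  proof (intro conjI allI impI)
    show "(u, x) \<in> topspace (prod_topology T X)" using uS x by (simp add: TS)
    show "\<pi> \<in> topspace (prod_topology T X) \<rightarrow> topspace X"
      using assms(6) by (simp add: semigroup_action_def TS)
    fix V assume V: "openin X V \<and> \<pi> (u, x) \<in> V"
    \<comment> \<open>Pulling \<open>V\<close> back along \<open>\<pi> (u, _)\<close> moves the
      problem to the identity: \<open>\<pi> (\<one>, x)\<close> lies in \<open>?V\<close> because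
      \<open>u\<close> times the identity is \<open>u\<close>.\<close>
    let ?V = "{y \<in> topspace X. \<pi> (u, y) \<in> V}"
    have "openin X ?V"
      using assms(7) uS(1) V unfolding separately_continuous_map_def TS
      by (intro openin_continuous_map_preimage) auto
    moreover have "\<pi> (\<one>\<^bsub>S\<^esub>, x) \<in> ?V"
      using V x uS \<pi>mult[of "\<one>\<^bsub>S\<^esub>" x] assms(6) by (auto simp: semigroup_action_def)
    ultimately obtain G where G: "openin (prod_topology T X) G" "(\<one>\<^bsub>S\<^esub>, x) \<in> G"
        "\<And>p. p \<in> G \<Longrightarrow> \<pi> (u, \<pi> p) \<in> V"
      using at1[unfolded topcontinuous_at_def, THEN conjunct2, THEN conjunct2, rule_format, of ?V] by auto
    \<comment> \<open>\<open>?h\<close> takes \<open>(u, x)\<close> to \<open>(\<one>, x)\<close>,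
      and \<open>\<pi> (u, \<pi> (?h p)) = \<pi> p\<close> because \<open>u\<close> cancels its
      inverse.\<close>
    let ?h = "\<lambda>p. (?u' \<otimes>\<^bsub>S\<^esub> fst p, snd p)"
    have "continuous_map (prod_topology T X) T (\<lambda>p. ?u' \<otimes>\<^bsub>S\<^esub> fst p)"
      using continuous_map_compose[OF continuous_map_fst, of T T "\<lambda>s. ?u' \<otimes>\<^bsub>S\<^esub> s" X] assms(1) uS(2)
      by (simp add: right_topological_monoid_def o_def)
    then have h: "continuous_map (prod_topology T X) (prod_topology T X) ?h"
      by (intro continuous_map_pairedI continuous_map_snd)
    show "\<exists>G. openin (prod_topology T X) G \<and> (u, x) \<in> G \<and> (\<forall>p\<in>G. \<pi> p \<in> V)"
    proof (intro exI[of _ "{p \<in> topspace (prod_topology T X). ?h p \<in> G}"] conjI ballI)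
      show "openin (prod_topology T X) {p \<in> topspace (prod_topology T X). ?h p \<in> G}"
        using h G(1) by (rule openin_continuous_map_preimage)
      show "(u, x) \<in> {p \<in> topspace (prod_topology T X). ?h p \<in> G}"
        using G(2) u uS x by (simp add: TS)
      fix p assume p: "p \<in> {p \<in> topspace (prod_topology T X). ?h p \<in> G}"
      then obtain s y where sy: "p = (s, y)" "s \<in> carrier S" "y \<in> topspace X" by (auto simp: TS)
      have "u \<otimes>\<^bsub>S\<^esub> (?u' \<otimes>\<^bsub>S\<^esub> s) = s"
        using u uS sy(2) by (simp add: S.m_assoc[symmetric])
      then have "\<pi> (u, \<pi> (?h p)) = \<pi> p"
        using \<pi>mult[of "?u' \<otimes>\<^bsub>S\<^esub> s" y] uS sy by simp
      then show "\<pi> p \<in> V" using G(3)[of "?h p"] p by simp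
    qed
  qed
qed

end
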